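(* Let $\sigma:\mathbb{R}\to\mathbb{R}$ be a Tauber-Wiener function, let $K_1\subset\mathbb{R}^{l}$ be a compact set in $\mathbb{R}^l$ and $K_2\subset\mathbb{R}^d$ a compact set in $\mathbb{R}^d$, and let $G$ be a (possibly nonlinear) continuous operator which maps $K_1$ into $C(K_2)$. Then for any $\epsilon>0$ there are positive integers $n,p$ and constants $c_i^k\in\mathbb{R}$, $\xi_i^k\in\mathbb{R}^l$, $\theta_i^k\in\mathbb{R}$, $\zeta_k\in\mathbb{R}$, $w_k\in\mathbb{R}^d$, for $i=1,\dots,n$, $k=1,\dots,p$, such that $$\left| G(\mathbf{u})(x)-\sum_{k=1}^p\sum_{i=1}^n c_i^k\,\sigma\left(\xi_i^k\cdot\mathbf{u}+\theta_i^k\right)\sigma\left(w_k\cdot x+\zeta_k\right)\right|<\epsilon$$ holds for all $\mathbf{u}\in K_1$ and $x\in K_2$.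
   Context: For a compact set $K$, $C(K)$ denotes the Banach space of all continuous real-valued functions on $K$ with norm $\|f\|_{C(K)}=\max_{x\in K}|f(x)|$. A function $g:\mathbb{R}\to\mathbb{R}$ (continuous or discontinuous) is called a Tauber-Wiener (TW) function if the set of all linear combinations $\sum_{i=1}^N c_i g(\lambda_i x+\theta_i)$, with $N\in\mathbb{N}$ and $\lambda_i,\theta_i,c_i\in\mathbb{R}$, is dense in every $C([a,b])$ (i.e. every continuous function on $[a,b]$ can be approximated uniformly on $[a,b]$ by such combinations). The dot denotes the Euclidean inner product. *)

theory Defs
  imports "HOL-Analysis.Analysis"
begin

text \<open>
  Since \<open>g\<close> may be discontinuous, its linear combinations need not lie in \<open>C([a,b])\<close>;
  density is meant as uniform approximability on the interval.
\<close>

definition tauber_wiener :: "(real \<Rightarrow> real) \<Rightarrow> bool" where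
  "tauber_wiener g \<longleftrightarrow>
    (\<forall>a b f. a \<le> b \<longrightarrow> continuous_on {a..b} f \<longrightarrow>
      (\<forall>\<epsilon>>0. \<exists>(N::nat) (c::nat \<Rightarrow> real) (\<mu>::nat \<Rightarrow> real) (\<theta>::nat \<Rightarrow> real).
        \<forall>x\<in>{a..b}. \<bar>f x - (\<Sum>i=1..N. c i * g (\<mu> i * x + \<theta> i))\<bar> < \<epsilon>))"

text \<open>
  The elements of \<open>C_space K\<close> are the bounded real functions continuous on \<open>K\<close>,
  normalised to \<open>undefined\<close> off \<open>K\<close>, under the supremum distance over \<open>K\<close>.
  For compact \<open>K\<close> boundedness is automatic and the distance is the maximum distance,
  so this is \<open>C(K)\<close>.
\<close>

abbreviation C_space :: "'a::topological_space set \<Rightarrow> ('a \<Rightarrow> real) metric" where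
  "C_space K \<equiv> cfunspace (top_of_set K) euclidean_metric"

end

theory Submission
  imports Defs
begin

text \<open>
  Evaluating \<open>G u\<close> at \<open>x\<close> turns the operator into one real function of the pair \<open>(u, x)\<close>. It is
  jointly continuous on the compact set \<open>K1 \<times> K2\<close>, because the distance of \<open>C(K2)\<close> controls all
  values \<open>G u x\<close> at once (\<open>continuous_on_case_prod_C_space\<close>). The claim
  thus becomes one about approximating a continuous real function of two vectors.

  The bridge to \<open>\<sigma>\<close> is the exponential function. The linear combinations of the functions
  \<open>z \<mapsto> exp (a \<bullet> z)\<close> form an algebra, since \<open>exp (a \<bullet> z) * exp (b \<bullet> z) = exp ((a + b) \<bullet> z)\<close>, so by
  Stone-Weierstrass they are dense in the continuous functions on any compact set
  (\<open>exponentials_dense\<close>). For a pair \<open>z = (u, x)\<close> such an exponential splits as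
  \<open>exp (a \<bullet> u) * exp (b \<bullet> x)\<close>. Each factor depends on its argument only through an inner product,
  which ranges over a bounded interval; the Tauber-Wiener property therefore approximates it by
  combinations of \<open>u \<mapsto> \<sigma> (\<xi> \<bullet> u + \<theta>)\<close>, respectively \<open>x \<mapsto> \<sigma> (w \<bullet> x + \<zeta>)\<close>
  (\<open>tauber_wiener_ridge_approx\<close>). Multiplying the two approximations out yields a linear combination
  of products \<open>\<sigma> (\<xi> \<bullet> u + \<theta>) * \<sigma> (w \<bullet> x + \<zeta>)\<close> (\<open>product_approx\<close>, \<open>lin_span_product\<close>).

  Such a combination already has the required shape with a single inner summand: every product
  gets its own outer index \<open>k\<close>, and repeated pairs \<open>(w k, \<zeta> k)\<close> do no harm.
\<close>

section \<open>Linear combinations of functions and uniform approximation\<close>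

text \<open>
  The zero function arises only as \<open>0 * b\<close> with \<open>b \<in> B\<close>, so \<open>lin_span {}\<close> is empty; hence
  the condition \<open>B \<noteq> {}\<close> in the next lemma.
\<close>

inductive_set lin_span :: "('a \<Rightarrow> real) set \<Rightarrow> ('a \<Rightarrow> real) set" for B where
  scale: "b \<in> B \<Longrightarrow> (\<lambda>z. c * b z) \<in> lin_span B"
| add: "f \<in> lin_span B \<Longrightarrow> g \<in> lin_span B \<Longrightarrow> (\<lambda>z. f z + g z) \<in> lin_span B"

lemma lin_span_sum:
  assumes "B \<noteq> {}" "finite I" "\<And>i. i \<in> I \<Longrightarrow> b i \<in> B"
  shows "(\<lambda>z. \<Sum>i\<in>I. c i * b i z) \<in> lin_span B"
  using assms(2,3)
proof (induction I rule: finite_induct)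
  case empty
  obtain b where "b \<in> B"
    using assms(1) by blast
  then show ?case
    using lin_span.scale[of b B 0] by simp
next
  case (insert i I)
  then show ?case
    by (simp add: lin_span.add lin_span.scale)
qed

text \<open>
  The maps \<open>p\<close> and \<open>q\<close> let one bilinear expansion serve twice: as identities they give closure under
  pointwise multiplication, as the two projections they give products of separate variables.
\<close>

lemma lin_span_product:
  assumes D: "\<And>b c. b \<in> B \<Longrightarrow> c \<in> C \<Longrightarrow> (\<lambda>z. b (p z) * c (q z)) \<in> D"
    and f: "f \<in> lin_span B" and g: "g \<in> lin_span C"
  shows "(\<lambda>z. f (p z) * g (q z)) \<in> lin_span D"
  using f
proof induction
  case (scale b r)
  from g show ?case
  proof induction
    case (scale c s)
    then show ?case
      using lin_span.scale[OF D[OF \<open>b \<in> B\<close> \<open>c \<in> C\<close>], of "r * s"] by (simp add: mult_ac)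
  next
    case (add g1 g2)
    then show ?case
      using lin_span.add[OF add.IH] by (simp add: distrib_left)
  qed
next
  case (add f1 f2)
  then show ?case
    using lin_span.add[OF add.IH] by (simp add: distrib_right)
qed

lemma lin_span_explicit:
  assumes "f \<in> lin_span B"
  obtains p :: nat and b c where "p > 0" "\<And>k. b k \<in> B" "\<And>z. f z = (\<Sum>k=1..p. c k * b k z)"
proof -
  from assms have "\<exists>(p::nat) c b. p > 0 \<and> (\<forall>k. b k \<in> B) \<and> (\<forall>z. f z = (\<Sum>k=1..p. c k * b k z))"
  proof induction
    case (scale b c)
    then show ?case
      by (intro exI[of _ 1] exI[of _ "\<lambda>_. c"] exI[of _ "\<lambda>_. b"]) simp
  next
    case (add f g)
    then obtain p c b q d e where
      f: "p > (0::nat)" "\<And>k. b k \<in> B" "\<And>z. f z = (\<Sum>k=1..p. c k * b k z)" and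
      g: "q > (0::nat)" "\<And>k. e k \<in> B" "\<And>z. g z = (\<Sum>k=1..q. d k * e k z)"
      by blast
    define c' where "c' k = (if k \<le> p then c k else d (k - p))" for k
    define b' where "b' k = (if k \<le> p then b k else e (k - p))" for k
    have "f z + g z = (\<Sum>k=1..p+q. c' k * b' k z)" for z
    proof -
      have "(\<Sum>k=1..p+q. c' k * b' k z) = (\<Sum>k=1..p. c' k * b' k z) + (\<Sum>k=p+1..p+q. c' k * b' k z)"
        by (rule sum.ub_add_nat) simp
      also have "(\<Sum>k=p+1..p+q. c' k * b' k z) = (\<Sum>k=1..q. c' (k + p) * b' (k + p) z)"
        using sum.shift_bounds_cl_nat_ivl[of "\<lambda>k. c' k * b' k z" 1 p q] by (simp add: add.commute)
      also have "\<dots> = g z"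
        unfolding g(3) by (intro sum.cong) (auto simp: c'_def b'_def)
      also have "(\<Sum>k=1..p. c' k * b' k z) = f z"
        unfolding f(3) by (intro sum.cong) (auto simp: c'_def b'_def)
      finally show ?thesis by simp
    qed
    moreover have "b' k \<in> B" for k
      using f(2) g(2) by (simp add: b'_def)
    ultimately show ?case
      using \<open>p > 0\<close> by (intro exI[of _ "p + q"] exI[of _ c'] exI[of _ b']) simp
  qed
  then show thesis
    using that by blast
qed

text \<open>
  Approximability passes from generators to their combinations, which makes uniform density
  transitive: it suffices to treat the single exponentials.
\<close>

lemma lin_span_approx:
  assumes B: "\<And>b \<delta>. b \<in> B \<Longrightarrow> \<delta> > 0 \<Longrightarrow> \<exists>h\<in>lin_span C. \<forall>z\<in>K. \<bar>b z - h z\<bar> < \<delta>"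
    and f: "f \<in> lin_span B" and "\<epsilon> > 0"
  shows "\<exists>h\<in>lin_span C. \<forall>z\<in>K. \<bar>f z - h z\<bar> < \<epsilon>"
  using f \<open>\<epsilon> > 0\<close>
proof (induction arbitrary: \<epsilon>)
  case (scale b c)
  \<comment> \<open>The summand 1 keeps the tolerance meaningful when \<open>c = 0\<close>.\<close>
  have pos: "\<epsilon> / (\<bar>c\<bar> + 1) > 0"
    using scale.prems by simp
  from B[OF \<open>b \<in> B\<close> pos] obtain h
    where h: "h \<in> lin_span C" "\<And>z. z \<in> K \<Longrightarrow> \<bar>b z - h z\<bar> < \<epsilon> / (\<bar>c\<bar> + 1)"
    by blast
  have "\<bar>c * b z - c * h z\<bar> < \<epsilon>" if "z \<in> K" for z
  proof -
    have "\<bar>c * b z - c * h z\<bar> = \<bar>c\<bar> * \<bar>b z - h z\<bar>"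
      by (simp add: abs_mult flip: right_diff_distrib)
    also have "\<dots> \<le> \<bar>c\<bar> * (\<epsilon> / (\<bar>c\<bar> + 1))"
      using h(2)[OF that] by (intro mult_left_mono) auto
    also have "\<dots> < \<epsilon>"
      using scale.prems by (simp add: divide_simps)
    finally show ?thesis .
  qed
  moreover from h(1) have "(\<lambda>z. c * h z) \<in> lin_span C"
  proof induction
    case (scale b d)
    then show ?case
      using lin_span.scale[of b C "c * d"] by (simp add: mult.assoc)
  next
    case (add f g)
    then show ?case
      using lin_span.add[OF add.IH] by (simp add: distrib_left)
  qed
  ultimately show ?case
    by (intro bexI[of _ "\<lambda>z. c * h z"]) auto
next
  case (add f g)
  have half: "\<epsilon> / 2 > 0"
    using add.prems by simp
  obtain h where h: "h \<in> lin_span C" "\<And>z. z \<in> K \<Longrightarrow> \<bar>f z - h z\<bar> < \<epsilon> / 2"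
    using add.IH(1)[OF half] by blast
  obtain k where k: "k \<in> lin_span C" "\<And>z. z \<in> K \<Longrightarrow> \<bar>g z - k z\<bar> < \<epsilon> / 2"
    using add.IH(2)[OF half] by blast
  have "\<bar>f z + g z - (h z + k z)\<bar> < \<epsilon>" if "z \<in> K" for z
    using h(2)[OF that] k(2)[OF that] by linarith
  then show ?case
    using lin_span.add[OF h(1) k(1)] by (intro bexI[of _ "\<lambda>z. h z + k z"]) auto
qed

lemma product_approx:
  fixes f :: "'a::topological_space \<Rightarrow> real" and g :: "'b::topological_space \<Rightarrow> real"
  assumes "compact K" "continuous_on K f" "compact L" "continuous_on L g"
    and F: "\<And>\<delta>. \<delta> > 0 \<Longrightarrow> \<exists>h\<in>F. \<forall>u\<in>K. \<bar>f u - h u\<bar> < \<delta>"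
    and G: "\<And>\<delta>. \<delta> > 0 \<Longrightarrow> \<exists>k\<in>G. \<forall>x\<in>L. \<bar>g x - k x\<bar> < \<delta>"
    and "\<epsilon> > 0"
  obtains h k where "h \<in> F" "k \<in> G" "\<And>u x. u \<in> K \<Longrightarrow> x \<in> L \<Longrightarrow> \<bar>f u * g x - h u * k x\<bar> < \<epsilon>"
proof -
  obtain A where A: "\<And>u. u \<in> K \<Longrightarrow> \<bar>f u\<bar> \<le> A" "A > 0"
    using compact_imp_bounded[OF compact_continuous_image[OF assms(2,1)]]
    by (auto simp: bounded_pos)
  obtain B where B: "\<And>x. x \<in> L \<Longrightarrow> \<bar>g x\<bar> \<le> B" "B > 0"
    using compact_imp_bounded[OF compact_continuous_image[OF assms(4,3)]]
    by (auto simp: bounded_pos)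
  \<comment> \<open>The error is at most \<open>A * \<delta> + (B + \<delta>) * \<delta>\<close>, and \<open>\<delta> \<le> 1\<close> makes this linear in \<open>\<delta>\<close>.\<close>
  define \<delta> where "\<delta> = min 1 (\<epsilon> / (A + B + 2))"
  have \<delta>: "\<delta> > 0" "\<delta> \<le> 1"
    using \<open>\<epsilon> > 0\<close> A(2) B(2) by (auto simp: \<delta>_def)
  have "\<delta> * (A + B + 2) \<le> \<epsilon>"
    using A(2) B(2) by (simp add: \<delta>_def pos_le_divide_eq[symmetric])
  then have \<delta>_bound: "A * \<delta> + (B + 1) * \<delta> < \<epsilon>"
    using \<delta>(1) by (simp add: algebra_simps)
  obtain h where h: "h \<in> F" "\<And>u. u \<in> K \<Longrightarrow> \<bar>f u - h u\<bar> < \<delta>"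
    using F[OF \<delta>(1)] by blast
  obtain k where k: "k \<in> G" "\<And>x. x \<in> L \<Longrightarrow> \<bar>g x - k x\<bar> < \<delta>"
    using G[OF \<delta>(1)] by blast
  have "\<bar>f u * g x - h u * k x\<bar> < \<epsilon>" if "u \<in> K" "x \<in> L" for u x
  proof -
    have "\<bar>k x\<bar> \<le> B + 1"
      using B(1)[OF that(2)] k(2)[OF that(2)] \<delta>(2) by linarith
    have "f u * g x - h u * k x = f u * (g x - k x) + k x * (f u - h u)"
      by (simp add: algebra_simps)
    then have "\<bar>f u * g x - h u * k x\<bar> \<le> \<bar>f u\<bar> * \<bar>g x - k x\<bar> + \<bar>k x\<bar> * \<bar>f u - h u\<bar>"
      by (metis abs_mult abs_triangle_ineq)
    also have "\<dots> \<le> A * \<delta> + (B + 1) * \<delta>"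
      using A B(2) h(2)[OF that(1)] k(2)[OF that(2)] that \<open>\<bar>k x\<bar> \<le> B + 1\<close>
      by (intro add_mono mult_mono) auto
    finally show ?thesis
      using \<delta>_bound by linarith
  qed
  with h(1) k(1) show thesis
    by (rule that)
qed

section \<open>Exponentials and ridge functions\<close>

definition exponentials :: "('a::real_inner \<Rightarrow> real) set" where
  "exponentials = range (\<lambda>a z. exp (a \<bullet> z))"

definition ridges :: "(real \<Rightarrow> real) \<Rightarrow> ('a::real_inner \<Rightarrow> real) set" where
  "ridges g = {\<lambda>u. g (\<xi> \<bullet> u + \<theta>) | \<xi> \<theta>. True}"

definition ridge_products :: "(real \<Rightarrow> real) \<Rightarrow> ('a::real_inner \<times> 'b::real_inner \<Rightarrow> real) set" where
  "ridge_products g = {\<lambda>z. r (fst z) * s (snd z) | r s. r \<in> ridges g \<and> s \<in> ridges g}"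

text \<open>
  Exponentials are chosen because their products are again exponentials, so that their linear span
  is already an algebra and Stone-Weierstrass applies to it directly.
\<close>

lemma exponentials_dense:
  fixes f :: "'a::real_inner \<Rightarrow> real"
  assumes "compact K" "continuous_on K f" "\<epsilon> > 0"
  shows "\<exists>h\<in>lin_span exponentials. \<forall>z\<in>K. \<bar>f z - h z\<bar> < \<epsilon>"
proof -
  interpret function_ring_on "lin_span exponentials" K
  proof
    show "compact K" by fact
  next
    fix f :: "'a \<Rightarrow> real" assume "f \<in> lin_span exponentials"
    then show "continuous_on K f"
      by induction (auto simp: exponentials_def intro!: continuous_intros)
  next
    fix f g :: "'a \<Rightarrow> real" assume "f \<in> lin_span exponentials" "g \<in> lin_span exponentials"
    then show "(\<lambda>z. f z + g z) \<in> lin_span exponentials"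
      by (rule lin_span.add)
  next
    fix f g :: "'a \<Rightarrow> real" assume fg: "f \<in> lin_span exponentials" "g \<in> lin_span exponentials"
    have "(\<lambda>z. b z * c z) \<in> exponentials"
      if "b \<in> exponentials" "c \<in> exponentials" for b c :: "'a \<Rightarrow> real"
      using that by (auto simp: exponentials_def inner_add_left[symmetric] simp flip: exp_add)
    then show "(\<lambda>z. f z * g z) \<in> lin_span exponentials"
      using lin_span_product[of exponentials exponentials "\<lambda>z. z" "\<lambda>z. z" exponentials f g] fg
      by simp
  next
    fix c :: real
    have "(\<lambda>z::'a. 1) \<in> exponentials"
      unfolding exponentials_def by (rule range_eqI[of _ _ 0]) simp
    from lin_span.scale[OF this, of c] show "(\<lambda>z::'a. c) \<in> lin_span exponentials"
      by simp
  next
    fix x y :: 'a assume "x \<noteq> y"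
    \<comment> \<open>The direction \<open>x - y\<close> separates: \<open>(x - y) \<bullet> x - (x - y) \<bullet> y\<close> is the squared distance.\<close>
    then have "(x - y) \<bullet> x \<noteq> (x - y) \<bullet> y"
      by (metis inner_diff_right inner_eq_zero_iff right_minus_eq)
    moreover have "(\<lambda>z. exp ((x - y) \<bullet> z)) \<in> lin_span exponentials"
      using lin_span.scale[of "\<lambda>z. exp ((x - y) \<bullet> z)" exponentials 1]
      by (simp add: exponentials_def)
    ultimately show "\<exists>f\<in>lin_span exponentials. f x \<noteq> f y"
      by (intro bexI[of _ "\<lambda>z. exp ((x - y) \<bullet> z)"]) auto
  qed
  show ?thesis
    using Stone_Weierstrass_basic[OF assms(2,3)] .
qed

text \<open>
  On a compact set the inner product with \<open>a\<close> stays in a bounded interval, where the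
  Tauber-Wiener property applies; a term \<open>g (\<mu> * t + \<theta>)\<close> at \<open>t = a \<bullet> u\<close> is the ridge function
  with direction \<open>\<mu> *\<^sub>R a\<close>.
\<close>

lemma tauber_wiener_ridge_approx:
  fixes K :: "'a::real_inner set"
  assumes "tauber_wiener g" "compact K" "continuous_on UNIV \<phi>" "\<epsilon> > 0"
  shows "\<exists>h\<in>lin_span (ridges g). \<forall>u\<in>K. \<bar>\<phi> (a \<bullet> u) - h u\<bar> < \<epsilon>"
proof -
  have "compact ((\<lambda>u. a \<bullet> u) ` K)"
    using assms(2) by (intro compact_continuous_image continuous_intros)
  then obtain R where R: "R > 0" "\<And>u. u \<in> K \<Longrightarrow> \<bar>a \<bullet> u\<bar> \<le> R"
    by (auto dest!: compact_imp_bounded simp: bounded_pos)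
  obtain N :: nat and c \<mu> \<theta> where
    approx: "\<And>t. t \<in> {-R..R} \<Longrightarrow> \<bar>\<phi> t - (\<Sum>i=1..N. c i * g (\<mu> i * t + \<theta> i))\<bar> < \<epsilon>"
  proof -
    have "-R \<le> R" "continuous_on {-R..R} \<phi>"
      using R(1) assms(3) continuous_on_subset by auto
    with assms(1,4) show thesis
      unfolding tauber_wiener_def using that by blast
  qed
  let ?h = "\<lambda>u. \<Sum>i=1..N. c i * g ((\<mu> i *\<^sub>R a) \<bullet> u + \<theta> i)"
  have "?h \<in> lin_span (ridges g)"
    by (rule lin_span_sum[where b = "\<lambda>i u. g ((\<mu> i *\<^sub>R a) \<bullet> u + \<theta> i)"])
      (unfold ridges_def, blast+)
  moreover have "\<bar>\<phi> (a \<bullet> u) - ?h u\<bar> < \<epsilon>" if "u \<in> K" for u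
    using approx[of "a \<bullet> u"] R(2)[OF that] by (simp add: abs_le_iff)
  ultimately show ?thesis
    by (intro bexI[of _ ?h]) auto
qed

text \<open>
  Both vectors enter through inner products alone, so the exponential of a pair factors into two
  functions to which the one-variable approximation applies separately.
\<close>

lemma exponential_approx_ridge_products:
  fixes b :: "'a::real_inner \<times> 'b::real_inner \<Rightarrow> real"
  assumes "tauber_wiener g" "compact K" "compact L" "b \<in> exponentials" "\<epsilon> > 0"
  shows "\<exists>h\<in>lin_span (ridge_products g). \<forall>z\<in>K \<times> L. \<bar>b z - h z\<bar> < \<epsilon>"
proof -
  obtain v w where b: "\<And>u x. b (u, x) = exp (v \<bullet> u) * exp (w \<bullet> x)"
    using assms(4) by (auto simp: exponentials_def exp_add)
  have "continuous_on UNIV (exp :: real \<Rightarrow> real)"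
    by (intro continuous_intros)
  note ridge = tauber_wiener_ridge_approx[OF assms(1) _ this]
  obtain h k where hk: "h \<in> lin_span (ridges g)" "k \<in> lin_span (ridges g)"
    "\<And>u x. u \<in> K \<Longrightarrow> x \<in> L \<Longrightarrow> \<bar>exp (v \<bullet> u) * exp (w \<bullet> x) - h u * k x\<bar> < \<epsilon>"
    by (rule product_approx[of K "\<lambda>u. exp (v \<bullet> u)" L "\<lambda>x. exp (w \<bullet> x)"
          "lin_span (ridges g)" "lin_span (ridges g)" \<epsilon>])
      (use assms in \<open>auto intro!: continuous_intros ridge\<close>)
  have "(\<lambda>z. h (fst z) * k (snd z)) \<in> lin_span (ridge_products g)"
    by (rule lin_span_product[OF _ hk(1,2)]) (unfold ridge_products_def, blast)
  then show ?thesis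
    by (rule bexI[rotated]) (auto simp: b hk(3))
qed

section \<open>Operators into a space of continuous functions\<close>

text \<open>
  In \<open>\<bar>G u x - G u0 x0\<bar> \<le> \<bar>G u x - G u0 x\<bar> + \<bar>G u0 x - G u0 x0\<bar>\<close> the first term is at most the
  distance of \<open>G u\<close> and \<open>G u0\<close>, whatever \<open>x\<close> is, and the second is small by the continuity of
  the single function \<open>G u0\<close>.
\<close>

lemma continuous_on_case_prod_C_space:
  fixes G :: "'a::topological_space \<Rightarrow> 'b::topological_space \<Rightarrow> real"
  assumes G: "continuous_map (top_of_set S) (mtopology_of (C_space T)) G"
  shows "continuous_on (S \<times> T) (\<lambda>(u, x). G u x)"
  unfolding continuous_on_def
proof (rule ballI, rule tendstoI)
  fix z :: "'a \<times> 'b" and e :: real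
  assume "z \<in> S \<times> T" "e > 0"
  then obtain u0 x0 where z: "z = (u0, x0)" and "u0 \<in> S" "x0 \<in> T"
    by blast
  from G have in_C: "G u \<in> mspace (C_space T)" if "u \<in> S" for u
    using that by (auto simp: continuous_map_def Pi_iff simp del: mspace_cfunspace)
  obtain U where U: "open U" "u0 \<in> U"
    and near: "\<And>u. u \<in> U \<Longrightarrow> u \<in> S \<Longrightarrow> mdist (C_space T) (G u0) (G u) < e / 2"
  proof -
    have "continuous_map (top_of_set S)
        (Metric_space.mtopology (mspace (C_space T)) (mdist (C_space T))) G"
      using G by (simp only: mtopology_of_def)
    with \<open>u0 \<in> S\<close> \<open>e > 0\<close> obtain V where "openin (top_of_set S) V" "u0 \<in> V"
      "\<And>u. u \<in> V \<Longrightarrow> mdist (C_space T) (G u0) (G u) < e / 2"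
      unfolding Metric_space.continuous_map_to_metric[OF Metric_space_mspace_mdist]
      by (metis Metric_space.in_mball Metric_space_mspace_mdist half_gt_zero topspace_euclidean_subtopology)
    then show thesis
      using that by (auto simp: openin_open)
  qed
  have sup_dist: "\<bar>G u x - G u0 x\<bar> < e / 2" if "u \<in> U" "u \<in> S" "x \<in> T" for u x
  proof -
    have "\<forall>y\<in>topspace (top_of_set T). mdist euclidean_metric (G u0 y) (G u y)
        \<le> mdist (C_space T) (G u0) (G u)"
      using cfunspace_mdist_le[OF in_C[OF \<open>u0 \<in> S\<close>] in_C[OF \<open>u \<in> S\<close>]] \<open>x \<in> T\<close> by force
    then have "dist (G u0 x) (G u x) \<le> mdist (C_space T) (G u0) (G u)"
      using \<open>x \<in> T\<close> by simp
    with near[OF that(1,2)] show ?thesis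
      unfolding dist_real_def by linarith
  qed
  have "continuous_on T (G u0)"
    using in_C[OF \<open>u0 \<in> S\<close>] by simp
  then have "(G u0 \<longlongrightarrow> G u0 x0) (at x0 within T)"
    using \<open>x0 \<in> T\<close> by (simp add: continuous_on_def)
  then have "\<forall>\<^sub>F x in at x0 within T. dist (G u0 x) (G u0 x0) < e / 2"
    using \<open>e > 0\<close> by (intro tendstoD) simp_all
  then obtain V where V: "open V" "x0 \<in> V"
    and near': "\<And>x. x \<in> V \<Longrightarrow> x \<in> T \<Longrightarrow> \<bar>G u0 x - G u0 x0\<bar> < e / 2"
    using \<open>e > 0\<close> unfolding eventually_at_topological dist_real_def
    by (metis abs_zero diff_self half_gt_zero)
  have "\<bar>G u x - G u0 x0\<bar> < e" if "u \<in> U" "u \<in> S" "x \<in> V" "x \<in> T" for u x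
    using sup_dist[OF that(1,2,4)] near'[OF that(3,4)] by linarith
  then show "\<forall>\<^sub>F y in at z within S \<times> T.
      dist (case y of (u, x) \<Rightarrow> G u x) (case z of (u, x) \<Rightarrow> G u x) < e"
    unfolding eventually_at_topological z
    using open_Times[OF U(1) V(1)] U(2) V(2)
    by (intro exI[of _ "U \<times> V"]) (auto simp: dist_real_def)
qed

section \<open>Approximation of operators\<close>

theorem theorem2:
  fixes \<sigma> :: "real \<Rightarrow> real"
    and K1 :: "(real ^ 'l) set"
    and K2 :: "(real ^ 'd) set"
    and G :: "real ^ 'l \<Rightarrow> real ^ 'd \<Rightarrow> real"
    and \<epsilon> :: real
  assumes "tauber_wiener \<sigma>"
    and "compact K1"
    and "compact K2"
    and "continuous_map (top_of_set K1) (mtopology_of (C_space K2)) G"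
    and "\<epsilon> > 0"
  shows "\<exists>(n::nat) (p::nat) (c :: nat \<Rightarrow> nat \<Rightarrow> real) (\<xi> :: nat \<Rightarrow> nat \<Rightarrow> real ^ 'l)
           (\<theta> :: nat \<Rightarrow> nat \<Rightarrow> real) (\<zeta> :: nat \<Rightarrow> real) (w :: nat \<Rightarrow> real ^ 'd).
           n > 0 \<and> p > 0 \<and>
           (\<forall>u\<in>K1. \<forall>x\<in>K2.
              \<bar>G u x - (\<Sum>k=1..p. \<Sum>i=1..n.
                 c i k * \<sigma> (\<xi> i k \<bullet> u + \<theta> i k) * \<sigma> (w k \<bullet> x + \<zeta> k))\<bar> < \<epsilon>)"
proof -
  have "\<epsilon> / 2 > 0"
    using assms(5) by simp
  from exponentials_dense[OF compact_Times[OF assms(2,3)]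
      continuous_on_case_prod_C_space[OF assms(4)] this]
  obtain f where f: "f \<in> lin_span exponentials"
    "\<And>z. z \<in> K1 \<times> K2 \<Longrightarrow> \<bar>(case z of (u, x) \<Rightarrow> G u x) - f z\<bar> < \<epsilon> / 2"
    by blast
  from lin_span_approx[OF exponential_approx_ridge_products[OF assms(1-3)] f(1) \<open>\<epsilon> / 2 > 0\<close>]
  obtain h where h: "h \<in> lin_span (ridge_products \<sigma>)"
    "\<And>z. z \<in> K1 \<times> K2 \<Longrightarrow> \<bar>f z - h z\<bar> < \<epsilon> / 2"
    by blast
  obtain p :: nat and b c where p: "p > 0" "\<And>k. b k \<in> ridge_products \<sigma>"
    and sum: "\<And>z. h z = (\<Sum>k=1..p. c k * b k z)"
    by (rule lin_span_explicit[OF h(1)], rule that)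
  have "\<exists>\<xi> \<theta> w \<zeta>. \<forall>u x. b k (u, x) = \<sigma> (\<xi> \<bullet> u + \<theta>) * \<sigma> (w \<bullet> x + \<zeta>)" for k
    using p(2)[of k] by (fastforce simp: ridge_products_def ridges_def)
  then obtain \<xi> \<theta> w \<zeta>
    where b: "\<And>k u x. b k (u, x) = \<sigma> (\<xi> k \<bullet> u + \<theta> k) * \<sigma> (w k \<bullet> x + \<zeta> k)"
    by metis
  \<comment> \<open>One inner summand suffices: each product of the combination has its own index \<open>k\<close>.\<close>
  have "\<bar>G u x - (\<Sum>k=1..p. \<Sum>i=1..(1::nat). c k * \<sigma> (\<xi> k \<bullet> u + \<theta> k) * \<sigma> (w k \<bullet> x + \<zeta> k))\<bar> < \<epsilon>"
    if "u \<in> K1" "x \<in> K2" for u x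
  proof -
    have "\<bar>G u x - h (u, x)\<bar> < \<epsilon>"
      using f(2)[of "(u, x)"] h(2)[of "(u, x)"] that
      unfolding split_conv mem_Times_iff fst_conv snd_conv by linarith
    then show ?thesis
      by (simp add: sum b mult.assoc)
  qed
  with p(1) show ?thesis
    by (intro exI[of _ "1::nat"] exI[of _ p] exI[of _ "\<lambda>i. c"] exI[of _ "\<lambda>i. \<xi>"]
        exI[of _ "\<lambda>i. \<theta>"] exI[of _ \<zeta>] exI[of _ w]) simp
qed

end
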